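(* Let a mixed-integer program be given by $A\in\mathbb{R}^{m\times n}$, $b\in\mathbb{R}^m$, $c\in\mathbb{R}^n$ and $p\in\{0,\dots,n\}$, let $j\in\{1,\dots,n\}$, and let $H_{Decomp}$ be the objective of the QUBO Decomposition over $\Pi_j$ associated with it. If $H_{Decomp}(\pi^*,\sigma^* )=0$ for some binary $\pi^*,\sigma^*$ (with the entries excluded from the formulation fixed to zero), then $\pi^*$ is a formulation symmetry that fixes the position of all $x_{j'}$ which cannot be reasonably permuted with $x_j$ (i.e. all $x_{j'}$ with $j'\notin r(j)$). Furthermore, if $\bar\pi$ is a formulation symmetry that fixes the position of all $x_{j'}$ which cannot be reasonably permuted with $x_j$, then there exists some $\bar\sigma$ such that $H_{Decomp}(\bar\pi,\bar\sigma)=0$.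
   Context: The mixed-integer program (MIP) is $\max\{c^Tx : Ax\le b,\ x\in\mathbb{Z}^p\times\mathbb{R}^{n-p}\}$, with $n$ variables $x_1,\dots,x_n$ (the first $p$ integer) and $m$ constraints. Formulation symmetry: a variable permutation $\pi\in S_n$ such that there exists a corresponding constraint permutation $\sigma\in S_m$ with (i) $\pi(\{1,\dots,p\})=\{1,\dots,p\}$; (ii) $\pi(c)=c$, i.e. $c_{\pi(k)}=c_k$ for all $k$; (iii) $\sigma(b)=b$, i.e. $b_{\sigma(i)}=b_i$ for all $i$; (iv) $A_{\sigma(i),\pi(k)}=A_{ik}$ for all $i,k$. It fixes the position of $x_{j'}$ if $\pi(j')=j'$. Matrix convention: a permutation $\pi\in S_n$ is identified with the matrix $\pi\in\{0,1\}^{n\times n}$ such that $\pi_{kk'}=1$ if and only if $\pi(k)=k'$ ($x_k$ is mapped to $x_{k'}$); similarly for $\sigma\in S_m$ and $\sigma\in\{0,1\}^{m\times m}$ ($\sigma_{ii'}=1$ iff constraint $i$ is mapped to constraint $i'$). A binary matrix is said to be a formulation symmetry if it is a permutation matrix whose permutation is a formulation symmetry. Reasonable index sets: for a variable index $j$, $r(j)$ is the set of all $j'\in\{1,\dots,n\}$ such that $x_j$ and $x_{j'}$ have the same domain (both integer or both continuous) and $c_j=c_{j'}$; then $x_{j'}$ can be reasonably permuted with $x_j$ iff $j'\in r(j)$. For a constraint index $i$, $r(i)$ is the set of all $i'\in\{1,\dots,m\}$ with $b_i=b_{i'}$. QUBO Decomposition over $\Pi_j$: the only decision variables are the binary entries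 in $$\Pi_j=\{\pi_{j'j''}: j',j''\in r(j)\}\cup\{\pi_{j'j'}: j'\notin r(j)\},\qquad \Sigma=\{\sigma_{ii'}: i'\in r(i),\ i\in\{1,\dots,m\}\};$$ all other entries of $\pi\in\{0,1\}^{n\times n}$ and $\sigma\in\{0,1\}^{m\times m}$ are fixed to zero (so all sums below effectively run over retained entries only). The objective is $H_{Decomp}(\pi,\sigma)=H_{B,\pi}+H_{B,\sigma}+H_A+H_{F,j}$, where $$H_{B,\pi}=\sum_{k=1}^n\Big(\sum_{k'=1}^n\pi_{kk'}-1\Big)^2+\sum_{k'=1}^n\Big(\sum_{k=1}^n\pi_{kk'}-1\Big)^2,$$ $$H_{B,\sigma}=\sum_{i=1}^m\Big(\sum_{i'=1}^m\sigma_{ii'}-1\Big)^2+\sum_{i'=1}^m\Big(\sum_{i=1}^m\sigma_{ii'}-1\Big)^2,$$ $$H_A=\sum_{(i,k,i',k'):\,A_{ik}\ne A_{i'k'}}\sigma_{ii'}\pi_{kk'},\qquad H_{F,j}=\sum_{j'\notin r(j)}(1-\pi_{j'j'})^2.$$ *)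

theory Defs
  imports "Jordan_Normal_Form.Matrix" "HOL-Combinatorics.Permutations"
begin

text \<open>
  The program \<open>max {c\<^sup>T x : A x \<le> b, x \<in> \<int>\<^sup>p \<times> \<real>\<^sup>n\<^sup>-\<^sup>p}\<close> is given by the data \<open>p\<close>, \<open>A\<close>, \<open>b\<close>, \<open>c\<close>.
  Indices are 0-based, as in the matrix library: the variables are \<open>0, \<dots>, n - 1\<close>, the integer
  ones are those below \<open>p\<close>, and the constraints are \<open>0, \<dots>, m - 1\<close>, where \<open>A\<close> is \<open>m \<times> n\<close>.
\<close>

definition formulation_symmetry ::
  "nat \<Rightarrow> real mat \<Rightarrow> real vec \<Rightarrow> real vec \<Rightarrow> (nat \<Rightarrow> nat) \<Rightarrow> bool" where
  "formulation_symmetry p A b c \<pi> \<longleftrightarrow>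
     \<pi> permutes {..<dim_col A} \<and>
     (\<exists>\<sigma>. \<sigma> permutes {..<dim_row A} \<and>
          \<pi> ` {..<p} = {..<p} \<and>
          (\<forall>k<dim_col A. c $ \<pi> k = c $ k) \<and>
          (\<forall>i<dim_row A. b $ \<sigma> i = b $ i) \<and>
          (\<forall>i<dim_row A. \<forall>k<dim_col A. A $$ (\<sigma> i, \<pi> k) = A $$ (i, k)))"

definition permutation_matrix :: "nat \<Rightarrow> (nat \<Rightarrow> nat) \<Rightarrow> real mat" where
  "permutation_matrix n \<pi> = mat n n (\<lambda>(k, k'). if \<pi> k = k' then 1 else 0)"

definition reasonable_vars :: "nat \<Rightarrow> real vec \<Rightarrow> nat \<Rightarrow> nat set" where
  "reasonable_vars p c j = {j'. j' < dim_vec c \<and> (j < p \<longleftrightarrow> j' < p) \<and> c $ j = c $ j'}"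

definition reasonable_cons :: "real vec \<Rightarrow> nat \<Rightarrow> nat set" where
  "reasonable_cons b i = {i'. i' < dim_vec b \<and> b $ i = b $ i'}"

text \<open>Index pairs of the binary decision variables; every other entry is fixed to zero.\<close>

definition retained_pi :: "nat \<Rightarrow> real vec \<Rightarrow> nat \<Rightarrow> (nat \<times> nat) set" where
  "retained_pi p c j =
     reasonable_vars p c j \<times> reasonable_vars p c j \<union>
     {(j', j') | j'. j' < dim_vec c \<and> j' \<notin> reasonable_vars p c j}"

definition retained_sigma :: "real vec \<Rightarrow> (nat \<times> nat) set" where
  "retained_sigma b = {(i, i'). i < dim_vec b \<and> i' \<in> reasonable_cons b i}"

definition binary_supported_on :: "nat \<Rightarrow> (nat \<times> nat) set \<Rightarrow> real mat \<Rightarrow> bool" where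
  "binary_supported_on d S M \<longleftrightarrow>
     M \<in> carrier_mat d d \<and>
     (\<forall>k<d. \<forall>k'<d. M $$ (k, k') \<in> {0, 1} \<and> ((k, k') \<notin> S \<longrightarrow> M $$ (k, k') = 0))"

definition decomp_assignment ::
  "nat \<Rightarrow> real vec \<Rightarrow> real vec \<Rightarrow> nat \<Rightarrow> real mat \<Rightarrow> real mat \<Rightarrow> bool" where
  "decomp_assignment p b c j \<pi> \<sigma> \<longleftrightarrow>
     binary_supported_on (dim_vec c) (retained_pi p c j) \<pi> \<and>
     binary_supported_on (dim_vec b) (retained_sigma b) \<sigma>"

text \<open>\<open>H_B\<close> serves both for \<open>H\<^sub>B\<^sub>,\<^sub>\<pi>\<close> (with \<open>d = n\<close>) and for \<open>H\<^sub>B\<^sub>,\<^sub>\<sigma>\<close> (with \<open>d = m\<close>).\<close>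

definition H_B :: "nat \<Rightarrow> real mat \<Rightarrow> real" where
  "H_B d M =
     (\<Sum>k<d. ((\<Sum>k'<d. M $$ (k, k')) - 1)\<^sup>2) + (\<Sum>k'<d. ((\<Sum>k<d. M $$ (k, k')) - 1)\<^sup>2)"

definition H_A :: "real mat \<Rightarrow> real mat \<Rightarrow> real mat \<Rightarrow> real" where
  "H_A A \<pi> \<sigma> =
     (\<Sum>(i, k, i', k') \<in> {(i, k, i', k').
          i < dim_row A \<and> k < dim_col A \<and> i' < dim_row A \<and> k' < dim_col A \<and>
          A $$ (i, k) \<noteq> A $$ (i', k')}.
        \<sigma> $$ (i, i') * \<pi> $$ (k, k'))"

definition H_F :: "nat \<Rightarrow> real vec \<Rightarrow> nat \<Rightarrow> real mat \<Rightarrow> real" where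
  "H_F p c j \<pi> = (\<Sum>j' \<in> {..<dim_vec c} - reasonable_vars p c j. (1 - \<pi> $$ (j', j'))\<^sup>2)"

definition H_Decomp ::
  "nat \<Rightarrow> real mat \<Rightarrow> real vec \<Rightarrow> real vec \<Rightarrow> nat \<Rightarrow> real mat \<Rightarrow> real mat \<Rightarrow> real" where
  "H_Decomp p A b c j \<pi> \<sigma> =
     H_B (dim_col A) \<pi> + H_B (dim_row A) \<sigma> + H_A A \<pi> \<sigma> + H_F p c j \<pi>"

end

theory Submission
  imports Defs
begin

text \<open>
  All four parts of the objective are nonnegative on binary assignments, so it vanishes iff each
  part does. \<open>H_B = 0\<close> says that the rows and columns sum to 1, i.e. that the matrix comes from
  a permutation; for such matrices the products in \<open>H_A\<close> count the entries of \<open>A\<close> that are not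
  preserved. The remaining symmetry conditions (on \<open>b\<close>, \<open>c\<close> and the variable domains) are
  encoded in the sets of retained entries.
\<close>

text \<open>A sum of 0/1 values is the number of indices with value 1, so the sum 1 makes this index
  set a singleton.\<close>

lemma sum_binary_eq_1_ex1:
  fixes f :: "'a \<Rightarrow> real"
  assumes "finite X" and "\<And>x. x \<in> X \<Longrightarrow> f x \<in> {0, 1}" and "sum f X = 1"
  shows "\<exists>!x. x \<in> X \<and> f x = 1"
proof -
  have "sum f X = (\<Sum>x\<in>X. if f x = 1 then 1 else 0)"
    using assms(2) by (intro sum.cong) auto
  also have "\<dots> = real (card {x \<in> X. f x = 1})"
    using assms(1) by (simp add: sum.If_cases Int_def)
  finally have "card {x \<in> X. f x = 1} = 1"
    using assms(3) by simp
  then obtain x where "{x \<in> X. f x = 1} = {x}"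
    by (auto simp: card_1_singleton_iff)
  then have "y \<in> X \<and> f y = 1 \<longleftrightarrow> y = x" for y
    by (simp add: set_eq_iff)
  then show ?thesis by simp
qed

lemma H_B_nonneg: "0 \<le> H_B d M"
  unfolding H_B_def by (intro add_nonneg_nonneg sum_nonneg) auto

lemma H_F_nonneg: "0 \<le> H_F p c j M"
  unfolding H_F_def by (intro sum_nonneg) auto

lemma binary_supported_on_nonneg:
  assumes "binary_supported_on d S M" and "k < d" and "k' < d"
  shows "0 \<le> M $$ (k, k')"
proof -
  have "M $$ (k, k') \<in> {0, 1}"
    using assms by (simp add: binary_supported_on_def)
  then show ?thesis by auto
qed

text \<open>Unlike \<open>H_B\<close> and \<open>H_F\<close>, which are sums of squares,
  \<open>H_A\<close> is bilinear; its sign comes from the entries being 0 or 1.\<close>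

lemma H_A_nonneg:
  assumes "binary_supported_on (dim_col A) S \<pi>" and "binary_supported_on (dim_row A) T \<sigma>"
  shows "0 \<le> H_A A \<pi> \<sigma>"
  unfolding H_A_def
  using assms by (intro sum_nonneg) (auto intro!: mult_nonneg_nonneg dest: binary_supported_on_nonneg)

lemma H_B_eq_0_iff:
  "H_B d M = 0 \<longleftrightarrow>
     (\<forall>k<d. (\<Sum>k'<d. M $$ (k, k')) = 1) \<and> (\<forall>k'<d. (\<Sum>k<d. M $$ (k, k')) = 1)"
  by (auto simp: H_B_def add_nonneg_eq_0_iff sum_nonneg sum_nonneg_eq_0_iff)

lemma H_B_permutation_matrix:
  assumes "\<pi> permutes {..<d}"
  shows "H_B d (permutation_matrix d \<pi>) = 0"
proof -
  have "(\<Sum>k'<d. permutation_matrix d \<pi> $$ (k, k')) = 1" if "k < d" for k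
  proof -
    have "\<pi> k < d" using permutes_in_image[OF assms, of k] that by simp
    then show ?thesis using that by (simp add: permutation_matrix_def)
  qed
  moreover have "(\<Sum>k<d. permutation_matrix d \<pi> $$ (k, k')) = 1" if "k' < d" for k'
  proof -
    \<comment> \<open>The single 1 of column \<open>k'\<close> sits in the row of the preimage of
      \<open>k'\<close>.\<close>
    obtain l where "\<pi> l = k'" using permutes_surj[OF assms] by (metis surjD)
    then have "l < d" and "\<pi> k = k' \<longleftrightarrow> k = l" for k
      using permutes_in_image[OF assms, of l] permutes_inj[OF assms] that by (auto dest: injD)
    then show ?thesis using that by (simp add: permutation_matrix_def)
  qed
  ultimately show ?thesis by (simp add: H_B_eq_0_iff)
qed

text \<open>The ones of the matrix are exactly the pairs on the graph of \<open>\<pi>\<close>. This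
  turns the choice of retained variables into pointwise conditions on the permutation.\<close>

lemma binary_supported_on_permutation_matrix_iff:
  assumes "\<pi> permutes {..<d}"
  shows "binary_supported_on d S (permutation_matrix d \<pi>) \<longleftrightarrow> (\<forall>k<d. (k, \<pi> k) \<in> S)"
proof -
  have "\<pi> k < d" if "k < d" for k
    using permutes_in_image[OF assms, of k] that by simp
  then show ?thesis
    by (auto simp: binary_supported_on_def permutation_matrix_def)
qed

text \<open>Unit row sums make the ones of \<open>M\<close> the graph of a function, unit column
  sums make this function injective, and an injective self-map of a finite set is bijective.\<close>

lemma H_B_eq_0_imp_permutation_matrix:
  assumes bin: "binary_supported_on d S M" and zero: "H_B d M = 0"
  obtains \<pi> where "\<pi> permutes {..<d}" and "M = permutation_matrix d \<pi>"
proof -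
  have entries: "M $$ (k, k') \<in> {0, 1}" if "k < d" "k' < d" for k k'
    using bin that by (simp add: binary_supported_on_def)
  have row: "\<exists>!k'. k' \<in> {..<d} \<and> M $$ (k, k') = 1" if "k < d" for k
    using entries zero that by (intro sum_binary_eq_1_ex1) (auto simp: H_B_eq_0_iff)
  have col: "\<exists>!k. k \<in> {..<d} \<and> M $$ (k, k') = 1" if "k' < d" for k'
    using entries zero that by (intro sum_binary_eq_1_ex1) (auto simp: H_B_eq_0_iff)
  \<comment> \<open>Outside \<open>{..<d}\<close> the map is the identity, as
    \<open>permutes\<close> demands.\<close>
  define \<pi> where "\<pi> k = (if k < d then THE k'. k' \<in> {..<d} \<and> M $$ (k, k') = 1 else k)" for k
  have \<pi>: "\<pi> k < d" "M $$ (k, \<pi> k) = 1" if "k < d" for k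
    using theI'[OF row[OF that]] that by (simp_all add: \<pi>_def)
  have uniq: "\<pi> k = k'" if "k < d" "k' < d" "M $$ (k, k') = 1" for k k'
    using row[OF that(1)] \<pi>[OF that(1)] that by blast
  \<comment> \<open>If \<open>\<pi> k = \<pi> l\<close>, then rows \<open>k\<close> and
    \<open>l\<close> both have a 1 in this column, which holds only one.\<close>
  have "inj_on \<pi> {..<d}"
  proof (rule inj_onI)
    fix k l assume "k \<in> {..<d}" "l \<in> {..<d}" "\<pi> k = \<pi> l"
    then show "k = l"
      using \<pi>[of k] \<pi>[of l] col[of "\<pi> k"] by (metis lessThan_iff)
  qed
  moreover have "\<pi> ` {..<d} \<subseteq> {..<d}"
    using \<pi>(1) by auto
  ultimately have "bij_betw \<pi> {..<d} {..<d}"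
    by (simp add: bij_betw_def endo_inj_surj)
  then have "\<pi> permutes {..<d}"
    by (rule bij_imp_permutes) (simp add: \<pi>_def)
  moreover have "M = permutation_matrix d \<pi>"
  proof (rule eq_matI)
    show "dim_row M = dim_row (permutation_matrix d \<pi>)"
      and "dim_col M = dim_col (permutation_matrix d \<pi>)"
      using bin by (auto simp: binary_supported_on_def permutation_matrix_def)
    fix k k' assume "k < dim_row (permutation_matrix d \<pi>)" "k' < dim_col (permutation_matrix d \<pi>)"
    then have "k < d" "k' < d" by (simp_all add: permutation_matrix_def)
    then show "M $$ (k, k') = permutation_matrix d \<pi> $$ (k, k')"
      using \<pi>(2)[of k] uniq[of k k'] entries[of k k'] by (auto simp: permutation_matrix_def)
  qed
  ultimately show ?thesis by (rule that)
qed

text \<open>The product for \<open>(i, k, i', k')\<close> is 1 if \<open>i' = \<sigma> i\<close> and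
  \<open>k' = \<pi> k\<close>, and 0 otherwise. So the sum vanishes iff no such quadruple pairs two
  different entries of \<open>A\<close>.\<close>

lemma H_A_permutation_matrix_eq_0_iff:
  assumes \<pi>: "\<pi> permutes {..<dim_col A}" and \<sigma>: "\<sigma> permutes {..<dim_row A}"
  shows "H_A A (permutation_matrix (dim_col A) \<pi>) (permutation_matrix (dim_row A) \<sigma>) = 0 \<longleftrightarrow>
    (\<forall>i<dim_row A. \<forall>k<dim_col A. A $$ (\<sigma> i, \<pi> k) = A $$ (i, k))"
proof -
  let ?I = "{(i, k, i', k'). i < dim_row A \<and> k < dim_col A \<and> i' < dim_row A \<and> k' < dim_col A \<and>
          A $$ (i, k) \<noteq> A $$ (i', k')}"
  \<comment> \<open>Over an infinite index set \<open>sum\<close> would be 0 by default, so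
    finiteness has to be shown before the terms can be judged one by one.\<close>
  have "finite ?I"
    by (rule finite_subset[of _ "{..<dim_row A} \<times> {..<dim_col A} \<times> {..<dim_row A} \<times> {..<dim_col A}"])
      auto
  then have "H_A A (permutation_matrix (dim_col A) \<pi>) (permutation_matrix (dim_row A) \<sigma>) = 0 \<longleftrightarrow>
    (\<forall>(i, k, i', k') \<in> ?I. \<not> (\<sigma> i = i' \<and> \<pi> k = k'))"
    unfolding H_A_def
    by (subst sum_nonneg_eq_0_iff) (auto simp: permutation_matrix_def)
  also have "\<dots> \<longleftrightarrow> (\<forall>i<dim_row A. \<forall>k<dim_col A. A $$ (\<sigma> i, \<pi> k) = A $$ (i, k))"
    using permutes_in_image[OF \<pi>] permutes_in_image[OF \<sigma>] by (simp add: Ball_def) metis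
  finally show ?thesis .
qed

lemma H_F_permutation_matrix_eq_0:
  assumes "\<forall>j'<dim_vec c. j' \<notin> reasonable_vars p c j \<longrightarrow> \<pi> j' = j'"
  shows "H_F p c j (permutation_matrix (dim_vec c) \<pi>) = 0"
  using assms by (auto simp: H_F_def permutation_matrix_def intro!: sum.neutral)

lemma retained_sigma_graph_iff:
  assumes "\<sigma> permutes {..<dim_vec b}"
  shows "(\<forall>i<dim_vec b. (i, \<sigma> i) \<in> retained_sigma b) \<longleftrightarrow> (\<forall>i<dim_vec b. b $ \<sigma> i = b $ i)"
proof -
  have "(i, \<sigma> i) \<in> retained_sigma b \<longleftrightarrow> b $ \<sigma> i = b $ i" if "i < dim_vec b" for i
    using permutes_in_image[OF assms, of i] that
    unfolding retained_sigma_def reasonable_cons_def by auto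
  then show ?thesis by blast
qed

text \<open>The pointwise form of condition (i) matches the same-domain clause of
  \<open>reasonable_vars\<close>. One direction is injectivity of \<open>\<pi>\<close>, the other is
  finiteness of \<open>{..<p}\<close>.\<close>

lemma permutes_image_lessThan_iff:
  fixes n p :: nat
  assumes "\<pi> permutes {..<n}" and "p \<le> n"
  shows "\<pi> ` {..<p} = {..<p} \<longleftrightarrow> (\<forall>k<n. \<pi> k < p \<longleftrightarrow> k < p)"
proof
  assume "\<pi> ` {..<p} = {..<p}"
  then show "\<forall>k<n. \<pi> k < p \<longleftrightarrow> k < p"
    using inj_image_mem_iff[OF permutes_inj[OF assms(1)], of _ "{..<p}"] by (metis lessThan_iff)
next
  assume "\<forall>k<n. \<pi> k < p \<longleftrightarrow> k < p"
  then have "\<pi> ` {..<p} \<subseteq> {..<p}" using assms(2) by auto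
  then show "\<pi> ` {..<p} = {..<p}"
    using permutes_inj_on[OF assms(1)] by (intro endo_inj_surj) auto
qed

text \<open>For \<open>k\<close> in r(j), the pair is retained iff \<open>\<pi> k\<close> is in
  r(j), that is, shares domain and cost with \<open>j\<close> and hence with \<open>k\<close>. For
  other \<open>k\<close> only the diagonal pair is retained, which forces
  \<open>\<pi> k = k\<close>.\<close>

lemma retained_pi_graph_iff:
  assumes \<pi>: "\<pi> permutes {..<dim_vec c}" and "p \<le> dim_vec c"
  shows "(\<forall>k<dim_vec c. (k, \<pi> k) \<in> retained_pi p c j) \<longleftrightarrow>
    \<pi> ` {..<p} = {..<p} \<and> (\<forall>k<dim_vec c. c $ \<pi> k = c $ k) \<and>
    (\<forall>j'<dim_vec c. j' \<notin> reasonable_vars p c j \<longrightarrow> \<pi> j' = j')"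
proof -
  have "(k, \<pi> k) \<in> retained_pi p c j \<longleftrightarrow> (\<pi> k < p \<longleftrightarrow> k < p) \<and> c $ \<pi> k = c $ k \<and>
      (k \<notin> reasonable_vars p c j \<longrightarrow> \<pi> k = k)" if "k < dim_vec c" for k
    using permutes_in_image[OF \<pi>, of k] that
    by (cases "k \<in> reasonable_vars p c j") (auto simp: retained_pi_def reasonable_vars_def)
  then show ?thesis
    unfolding permutes_image_lessThan_iff[OF assms] by blast
qed

theorem proposition3:
  fixes A :: "real mat" and b c :: "real vec" and m n p j :: nat
  assumes "A \<in> carrier_mat m n" and "b \<in> carrier_vec m" and "c \<in> carrier_vec n"
    and "p \<le> n" and "j < n"
  shows
    "(\<forall>\<pi>_star \<sigma>_star :: real mat.
        decomp_assignment p b c j \<pi>_star \<sigma>_star \<and> H_Decomp p A b c j \<pi>_star \<sigma>_star = 0 \<longrightarrow>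
        (\<exists>\<pi>. \<pi>_star = permutation_matrix n \<pi> \<and> formulation_symmetry p A b c \<pi> \<and>
             (\<forall>j'<n. j' \<notin> reasonable_vars p c j \<longrightarrow> \<pi> j' = j'))) \<and>
     (\<forall>\<pi>. formulation_symmetry p A b c \<pi> \<and>
          (\<forall>j'<n. j' \<notin> reasonable_vars p c j \<longrightarrow> \<pi> j' = j') \<longrightarrow>
          (\<exists>\<sigma>_bar :: real mat.
             decomp_assignment p b c j (permutation_matrix n \<pi>) \<sigma>_bar \<and>
             H_Decomp p A b c j (permutation_matrix n \<pi>) \<sigma>_bar = 0))"
proof -
  have dims: "dim_row A = m" "dim_col A = n" "dim_vec b = m" "dim_vec c = n"
    using assms by auto
  show ?thesis
  proof (intro conjI allI impI; elim conjE)
    fix M N :: "real mat"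
    assume "decomp_assignment p b c j M N" and zero: "H_Decomp p A b c j M N = 0"
    then have M: "binary_supported_on n (retained_pi p c j) M"
      and N: "binary_supported_on m (retained_sigma b) N"
      by (simp_all add: decomp_assignment_def dims)
    have "0 \<le> H_A A M N"
      using H_A_nonneg[of A] M N by (simp add: dims)
    then have H: "H_B n M = 0" "H_B m N = 0" "H_A A M N = 0"
      using zero H_B_nonneg[of n M] H_B_nonneg[of m N] H_F_nonneg[of p c j M]
      unfolding H_Decomp_def dims by linarith+
    from M H(1) obtain \<pi> where \<pi>: "\<pi> permutes {..<n}" "M = permutation_matrix n \<pi>"
      by (rule H_B_eq_0_imp_permutation_matrix)
    from N H(2) obtain \<sigma> where \<sigma>: "\<sigma> permutes {..<m}" "N = permutation_matrix m \<sigma>"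
      by (rule H_B_eq_0_imp_permutation_matrix)
    \<comment> \<open>The support of \<open>M\<close> alone yields domains, costs and the fixed
      positions.\<close>
    have "\<pi> ` {..<p} = {..<p} \<and> (\<forall>k<n. c $ \<pi> k = c $ k) \<and>
        (\<forall>j'<n. j' \<notin> reasonable_vars p c j \<longrightarrow> \<pi> j' = j')"
      using M \<pi> retained_pi_graph_iff[of \<pi> c p j] \<open>p \<le> n\<close>
      by (simp add: binary_supported_on_permutation_matrix_iff dims)
    moreover have "\<forall>i<m. b $ \<sigma> i = b $ i"
      using N \<sigma> retained_sigma_graph_iff[of \<sigma> b]
      by (simp add: binary_supported_on_permutation_matrix_iff dims)
    moreover have "\<forall>i<m. \<forall>k<n. A $$ (\<sigma> i, \<pi> k) = A $$ (i, k)"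
      using H(3) \<pi> \<sigma> H_A_permutation_matrix_eq_0_iff[of \<pi> A \<sigma>] by (simp add: dims)
    ultimately show "\<exists>\<pi>. M = permutation_matrix n \<pi> \<and> formulation_symmetry p A b c \<pi> \<and>
        (\<forall>j'<n. j' \<notin> reasonable_vars p c j \<longrightarrow> \<pi> j' = j')"
      using \<pi> \<sigma>(1) unfolding formulation_symmetry_def dims by blast
  next
    fix \<pi>
    assume "formulation_symmetry p A b c \<pi>"
      and fixed: "\<forall>j'<n. j' \<notin> reasonable_vars p c j \<longrightarrow> \<pi> j' = j'"
    then obtain \<sigma> where \<pi>: "\<pi> permutes {..<n}" and \<sigma>: "\<sigma> permutes {..<m}"
      and sym: "\<pi> ` {..<p} = {..<p}" "\<forall>k<n. c $ \<pi> k = c $ k" "\<forall>i<m. b $ \<sigma> i = b $ i"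
        "\<forall>i<m. \<forall>k<n. A $$ (\<sigma> i, \<pi> k) = A $$ (i, k)"
      unfolding formulation_symmetry_def dims by blast
    \<comment> \<open>The witness is the matrix of the constraint permutation that comes with the
      symmetry \<open>\<pi>\<close>.\<close>
    let ?M = "permutation_matrix n \<pi>" and ?N = "permutation_matrix m \<sigma>"
    have "decomp_assignment p b c j ?M ?N"
      using retained_pi_graph_iff[of \<pi> c p j] retained_sigma_graph_iff[of \<sigma> b] \<pi> \<sigma> sym fixed \<open>p \<le> n\<close>
      by (simp add: decomp_assignment_def binary_supported_on_permutation_matrix_iff dims)
    \<comment> \<open>Both \<open>H_B\<close> terms vanish on permutation matrices,
      \<open>H_A\<close> by the invariance of \<open>A\<close>, and \<open>H_F\<close> because the
      positions outside r(j) are fixed.\<close>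
    moreover have "H_Decomp p A b c j ?M ?N = 0"
      using H_A_permutation_matrix_eq_0_iff[of \<pi> A \<sigma>] H_F_permutation_matrix_eq_0[of c p j \<pi>]
        \<pi> \<sigma> sym(4) fixed
      by (simp add: H_Decomp_def H_B_permutation_matrix dims)
    ultimately show "\<exists>N. decomp_assignment p b c j ?M N \<and> H_Decomp p A b c j ?M N = 0"
      by blast
  qed
qed

end
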